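(* Let $\alpha=(\alpha_{r,m}:C([-r,r]^m)\to[0,\infty])_{r>0,\,m\in\mathbb N}$ be a family of possibly infinite norms, and let $\mathcal A$ be a unital $C^*$-algebra. Write $\mathcal A_{\mathrm{sa}}:=\{a\in\mathcal A:a^*=a\}$ and $\mathcal A_{\mathrm{sa},r}:=\{a\in\mathcal A_{\mathrm{sa}}:\|a\|\le r\}$ for $r\ge0$. Suppose $\alpha$ is finite on polynomials and that for every $m\ge2$, $P\in\mathcal P_m$, and $b=(b_1,\ldots,b_{m-1})\in\mathcal A^{m-1}$, $$\sup_{\mathbf a\in\mathcal A_{\mathrm{sa},r}^m}\|P_\otimes(\mathbf a)\# b\|\le\alpha_{r,m}(P)\prod_{i=1}^{m-1}\|b_i\|\qquad(r>0).$$ If $m\ge2$, $\mathbf a\in\mathcal A_{\mathrm{sa}}^m$, and $b\in\mathcal A^{m-1}$, then the map $\mathcal P_m\ni P\mapsto P_\otimes(\mathbf a)\# b\in\mathcal A$ extends uniquely to a continuous linear map $\Phi:C_\alpha(\mathbb R^m)\to\mathcal A$.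
   Context: A possibly infinite norm on a complex vector space $V$ is a function $\eta:V\to[0,\infty]$ with $\eta(cv)=|c|\eta(v)$ (convention $0\cdot\infty=0$), $\eta(v+w)\le\eta(v)+\eta(w)$, and $\eta(v)=0$ iff $v=0$. $C(X)$ denotes complex-valued continuous functions on $X$. If $\varphi$ is a continuous function whose domain contains $[-r,r]^m$, write $\alpha_{r,m}(\varphi):=\alpha_{r,m}(\varphi|_{[-r,r]^m})$. Let $\mathcal C_\alpha(\mathbb R^m):=\{\varphi\in C(\mathbb R^m):\alpha_{r,m}(\varphi)<\infty\text{ for all }r>0\}$, with the locally convex topology generated by the seminorms $\varphi\mapsto\alpha_{r,m}(\varphi)$, $r>0$. $\mathcal P_m:=\mathbb C[\lambda_1,\ldots,\lambda_m]$, viewed as functions $\mathbb R^m\to\mathbb C$. The family $\alpha$ is finite on polynomials if $\mathcal P_m\subseteq\mathcal C_\alpha(\mathbb R^m)$ for all $m\in\mathbb N$; in this case $C_\alpha(\mathbb R^m)$ is the closure of $\mathcal P_m$ in $\mathcal C_\alpha(\mathbb R^m)$ (with the subspace topology). For $m\ge2$, $P(\boldsymbol\lambda)=\sum_{|\delta|\le d}c_\delta\lambda_1^{\delta_1}\cdots\lambda_m^{\delta_m}\in\mathcal P_m$, $\mathbf a=(a_1,\ldots,a_m)\in\mathcal A^m$, and $b=(b_1,\ldots,b_{m-1})\in\mathcal A^{m-1}$, $$P_\otimes(\mathbf a)\# b=\sum_{|\delta|\le d}c_\delta\,a_1^{\delta_1}b_1\cdots a_{m-1}^{\delta_{m-1}}b_{m-1}a_m^{\delta_m}\in\mathcal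 A.$$ (In the paper, the extension is denoted $\varphi_{\mathcal A,\alpha}(\mathbf a)\# b:=\Phi(\varphi)$, and is called the $m$-variate $\alpha$-lexicographic functional calculus.) *)

theory Defs
  imports "HOL-Analysis.Analysis" "HOL-Analysis.Abstract_Euclidean_Space" "HOL-Library.Poly_Mapping"
begin

(* The unit comes from monoid_mult rather than from real_normed_algebra_1, because the latter
   postulates norm 1 = 1 and would exclude the zero algebra. *)
class unital_cstar_algebra = real_normed_algebra + banach + monoid_mult +
  fixes scaleC :: "complex \<Rightarrow> 'a \<Rightarrow> 'a"  (infixr "*\<^sub>C" 75)
    and star :: "'a \<Rightarrow> 'a"
  assumes scaleC_add_right: "c *\<^sub>C (x + y) = c *\<^sub>C x + c *\<^sub>C y"
    and scaleC_add_left: "(c + d) *\<^sub>C x = c *\<^sub>C x + d *\<^sub>C x"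
    and scaleC_scaleC: "c *\<^sub>C d *\<^sub>C x = (c * d) *\<^sub>C x"
    and scaleC_of_real: "complex_of_real t *\<^sub>C x = t *\<^sub>R x"
    and mult_scaleC_left: "(c *\<^sub>C x) * y = c *\<^sub>C (x * y)"
    and mult_scaleC_right: "x * (c *\<^sub>C y) = c *\<^sub>C (x * y)"
    and norm_scaleC: "norm (c *\<^sub>C x) = cmod c * norm x"
    and star_star: "star (star x) = x"
    and star_add: "star (x + y) = star x + star y"
    and star_scaleC: "star (c *\<^sub>C x) = cnj c *\<^sub>C star x"
    and star_mult: "star (x * y) = star y * star x"
    and cstar_identity: "norm (star x * x) = (norm x)\<^sup>2"

definition self_adjoint :: "'a::unital_cstar_algebra set"
  where "self_adjoint = {a. star a = a}"

definition self_adjoint_ball :: "real \<Rightarrow> 'a::unital_cstar_algebra set"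
  where "self_adjoint_ball r = {a \<in> self_adjoint. norm a \<le> r}"

(* Complex-valued functions on a set S are represented by total functions that vanish off S, so
   that function spaces on S are linear subspaces under the pointwise operations. *)
definition restrict0 :: "'x set \<Rightarrow> ('x \<Rightarrow> complex) \<Rightarrow> 'x \<Rightarrow> complex"
  where "restrict0 S f = (\<lambda>x. if x \<in> S then f x else 0)"

definition cfuns :: "'x topology \<Rightarrow> ('x \<Rightarrow> complex) set"
  where "cfuns X = {f. continuous_map X euclidean f \<and> (\<forall>x. x \<notin> topspace X \<longrightarrow> f x = 0)}"

(* In ennreal, 0 * top = 0, as required by the convention for possibly infinite norms. *)
definition inf_norm_on :: "('x \<Rightarrow> complex) set \<Rightarrow> (('x \<Rightarrow> complex) \<Rightarrow> ennreal) \<Rightarrow> bool"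
  where "inf_norm_on V \<eta> \<longleftrightarrow>
    (\<forall>f\<in>V. \<forall>c. \<eta> (\<lambda>x. c * f x) = ennreal (cmod c) * \<eta> f) \<and>
    (\<forall>f\<in>V. \<forall>g\<in>V. \<eta> (\<lambda>x. f x + g x) \<le> \<eta> f + \<eta> g) \<and>
    (\<forall>f\<in>V. \<eta> f = 0 \<longleftrightarrow> f = (\<lambda>x. 0))"

(* The points of Euclidean_space m are the sequences x with x i = 0 for all i \<ge> m; coordinates
   are numbered from 0. *)
definition cube :: "real \<Rightarrow> nat \<Rightarrow> (nat \<Rightarrow> real) set"
  where "cube r m = {x \<in> topspace (Euclidean_space m). \<forall>i<m. - r \<le> x i \<and> x i \<le> r}"

type_synonym norm_family = "real \<Rightarrow> nat \<Rightarrow> ((nat \<Rightarrow> real) \<Rightarrow> complex) \<Rightarrow> ennreal"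

definition inf_norm_family :: "norm_family \<Rightarrow> bool"
  where "inf_norm_family \<alpha> \<longleftrightarrow>
    (\<forall>r>0. \<forall>m\<ge>1. inf_norm_on (cfuns (subtopology (Euclidean_space m) (cube r m))) (\<alpha> r m))"

definition norm_on_cube :: "norm_family \<Rightarrow> real \<Rightarrow> nat \<Rightarrow> ((nat \<Rightarrow> real) \<Rightarrow> complex) \<Rightarrow> ennreal"
  where "norm_on_cube \<alpha> r m \<phi> = \<alpha> r m (restrict0 (cube r m) \<phi>)"

definition seminorm_topology ::
    "('x \<Rightarrow> complex) set \<Rightarrow> (('x \<Rightarrow> complex) \<Rightarrow> ennreal) set \<Rightarrow> ('x \<Rightarrow> complex) topology"
  where "seminorm_topology V S = topology_generated_by
    {{g \<in> V. p (\<lambda>x. g x - f x) < ennreal e} |p f e. p \<in> S \<and> f \<in> V \<and> 0 < e}"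

definition fin_funs :: "norm_family \<Rightarrow> nat \<Rightarrow> ((nat \<Rightarrow> real) \<Rightarrow> complex) set"
  where "fin_funs \<alpha> m = {\<phi> \<in> cfuns (Euclidean_space m). \<forall>r>0. norm_on_cube \<alpha> r m \<phi> < \<infinity>}"

definition fin_funs_topology :: "norm_family \<Rightarrow> nat \<Rightarrow> ((nat \<Rightarrow> real) \<Rightarrow> complex) topology"
  where "fin_funs_topology \<alpha> m =
    seminorm_topology (fin_funs \<alpha> m) {norm_on_cube \<alpha> r m |r. 0 < r}"

type_synonym cpoly = "(nat \<Rightarrow>\<^sub>0 nat) \<Rightarrow>\<^sub>0 complex"

definition polys :: "nat \<Rightarrow> cpoly set"
  where "polys m = {P. \<forall>\<delta>\<in>Poly_Mapping.keys P. Poly_Mapping.keys \<delta> \<subseteq> {..<m}}"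

definition poly_fun :: "nat \<Rightarrow> cpoly \<Rightarrow> (nat \<Rightarrow> real) \<Rightarrow> complex"
  where "poly_fun m P = restrict0 (topspace (Euclidean_space m))
    (\<lambda>x. \<Sum>\<delta>\<in>Poly_Mapping.keys P.
      Poly_Mapping.lookup P \<delta> * (\<Prod>i<m. complex_of_real (x i) ^ Poly_Mapping.lookup \<delta> i))"

definition finite_on_polys :: "norm_family \<Rightarrow> bool"
  where "finite_on_polys \<alpha> \<longleftrightarrow> (\<forall>m\<ge>1. poly_fun m ` polys m \<subseteq> fin_funs \<alpha> m)"

definition poly_closure :: "norm_family \<Rightarrow> nat \<Rightarrow> ((nat \<Rightarrow> real) \<Rightarrow> complex) set"
  where "poly_closure \<alpha> m = fin_funs_topology \<alpha> m closure_of (poly_fun m ` polys m)"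

definition poly_closure_topology :: "norm_family \<Rightarrow> nat \<Rightarrow> ((nat \<Rightarrow> real) \<Rightarrow> complex) topology"
  where "poly_closure_topology \<alpha> m = subtopology (fin_funs_topology \<alpha> m) (poly_closure \<alpha> m)"

(* P_\<otimes>(a)#b for m \<ge> 1. Only a 0, ..., a (m - 1) and b 0, ..., b (m - 2) matter; the product of the
   list is taken from left to right. *)
definition poly_tensor_apply ::
    "nat \<Rightarrow> cpoly \<Rightarrow> (nat \<Rightarrow> 'a) \<Rightarrow> (nat \<Rightarrow> 'a) \<Rightarrow> 'a::unital_cstar_algebra"
  where "poly_tensor_apply m P a b = (\<Sum>\<delta>\<in>Poly_Mapping.keys P. Poly_Mapping.lookup P \<delta> *\<^sub>C
    (prod_list (map (\<lambda>i. a i ^ Poly_Mapping.lookup \<delta> i * b i) [0..<m - 1])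
      * a (m - 1) ^ Poly_Mapping.lookup \<delta> (m - 1)))"

definition clinear_on ::
    "('x \<Rightarrow> complex) set \<Rightarrow> (('x \<Rightarrow> complex) \<Rightarrow> 'a::unital_cstar_algebra) \<Rightarrow> bool"
  where "clinear_on V \<Phi> \<longleftrightarrow>
    (\<forall>f\<in>V. \<forall>g\<in>V. \<Phi> (\<lambda>x. f x + g x) = \<Phi> f + \<Phi> g) \<and>
    (\<forall>f\<in>V. \<forall>c. \<Phi> (\<lambda>x. c * f x) = c *\<^sub>C \<Phi> f)"

end

theory Submission
  imports Defs
begin

text \<open>The hypothesis bounds \<open>P \<mapsto> P\<^sub>\<otimes>(a)#b\<close> by a single seminorm of the space: if \<open>r\<close> exceeds
  the norms of all \<open>a i\<close>, then \<open>norm (P\<^sub>\<otimes>(a)#b) \<le> B * \<alpha>\<^sub>r\<^sub>,\<^sub>m(P)\<close> with \<open>B = \<Prod>i. norm (b i)\<close>.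
  The bound does two things. It makes \<open>P\<^sub>\<otimes>(a)#b\<close> depend only on the function of \<open>P\<close>: two
  polynomials with the same function differ by one whose function has seminorm \<open>0\<close>. And the
  resulting linear map on polynomial functions is Lipschitz for one continuous seminorm, so it
  extends to the closure, because the algebra is complete. Continuous extensions are unique because
  a set is dense in its closure and the norm topology is Hausdorff. This is
  \<open>bounded_linear_extension_unique\<close>, which holds in every space of functions whose topology comes
  from finite seminorms.

  Although the estimate involves a single seminorm, the whole family enters in one place: the
  closure of the polynomials has to be a linear space, and the family of seminorms need not be
  directed, so approximation in finitely many seminorms at once has to be considered
  (\<open>in_closure_iff_approximable\<close>).\<close>

section \<open>Scalars in a unital C*-algebra\<close>

lemma scaleC_zero_left: "0 *\<^sub>C x = (0::'a::unital_cstar_algebra)"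
  using scaleC_of_real[of 0 x] by simp

lemma scaleC_minus_one: "(- 1) *\<^sub>C x = - (x::'a::unital_cstar_algebra)"
  using scaleC_of_real[of "-1" x] by simp

lemma scaleC_diff_right: "c *\<^sub>C (x - y) = c *\<^sub>C x - c *\<^sub>C (y::'a::unital_cstar_algebra)"
  using scaleC_add_right[of c "x - y" y] by (simp add: algebra_simps)

lemma clinear_on_diff:
  fixes T :: "('x \<Rightarrow> complex) \<Rightarrow> 'a::unital_cstar_algebra"
  assumes "clinear_on D T" "f \<in> D" "g \<in> D" "\<And>f c. f \<in> D \<Longrightarrow> (\<lambda>x. c * f x) \<in> D"
  shows "T (\<lambda>x. f x - g x) = T f - T g"
proof -
  have "(\<lambda>x. - 1 * g x) \<in> D"
    using assms(3,4) by blast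
  then have "T (\<lambda>x. f x + (- 1 * g x)) = T f + (- 1) *\<^sub>C T g"
    using assms(1-3) unfolding clinear_on_def by metis
  then show ?thesis
    by (simp add: scaleC_minus_one)
qed

section \<open>Spaces of functions topologised by finite seminorms\<close>

locale seminormed_function_space =
  fixes V :: "('x \<Rightarrow> complex) set" and S :: "(('x \<Rightarrow> complex) \<Rightarrow> ennreal) set"
  assumes add_closed: "f \<in> V \<Longrightarrow> g \<in> V \<Longrightarrow> (\<lambda>x. f x + g x) \<in> V"
    and scale_closed: "f \<in> V \<Longrightarrow> (\<lambda>x. c * f x) \<in> V"
    and seminorm_scale: "p \<in> S \<Longrightarrow> f \<in> V \<Longrightarrow> p (\<lambda>x. c * f x) = ennreal (cmod c) * p f"
    and seminorm_triangle: "p \<in> S \<Longrightarrow> f \<in> V \<Longrightarrow> g \<in> V \<Longrightarrow> p (\<lambda>x. f x + g x) \<le> p f + p g"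
    and seminorm_finite: "p \<in> S \<Longrightarrow> f \<in> V \<Longrightarrow> p f < \<infinity>"
    and seminorms_nonempty: "S \<noteq> {}"
begin

lemma diff_closed: "f \<in> V \<Longrightarrow> g \<in> V \<Longrightarrow> (\<lambda>x. f x - g x) \<in> V"
  using add_closed[of f "\<lambda>x. - 1 * g x"] scale_closed[of g "- 1"] by simp

definition dist_wrt :: "(('x \<Rightarrow> complex) \<Rightarrow> ennreal) \<Rightarrow> ('x \<Rightarrow> complex) \<Rightarrow> ('x \<Rightarrow> complex) \<Rightarrow> real"
  where "dist_wrt p f g = enn2real (p (\<lambda>x. f x - g x))"

lemma ennreal_dist_wrt:
  assumes "p \<in> S" "f \<in> V" "g \<in> V"
  shows "ennreal (dist_wrt p f g) = p (\<lambda>x. f x - g x)"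
  using seminorm_finite[OF assms(1) diff_closed[OF assms(2,3)]] by (simp add: dist_wrt_def)

lemma dist_wrt_nonneg: "0 \<le> dist_wrt p f g"
  by (simp add: dist_wrt_def)

lemma dist_wrt_less_iff:
  assumes "p \<in> S" "f \<in> V" "g \<in> V" "0 < e"
  shows "p (\<lambda>x. f x - g x) < ennreal e \<longleftrightarrow> dist_wrt p f g < e"
  using ennreal_dist_wrt[OF assms(1-3)] dist_wrt_nonneg assms(4)
  by (metis ennreal_less_iff)

lemma dist_wrt_scale:
  assumes "p \<in> S" "f \<in> V" "g \<in> V"
  shows "dist_wrt p (\<lambda>x. c * f x) (\<lambda>x. c * g x) = cmod c * dist_wrt p f g"
proof -
  have "(\<lambda>x. c * f x - c * g x) = (\<lambda>x. c * (f x - g x))"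
    by (simp add: algebra_simps)
  then show ?thesis
    using seminorm_scale[OF assms(1) diff_closed[OF assms(2,3)], of c]
    by (simp add: dist_wrt_def enn2real_mult)
qed

lemma dist_wrt_self:
  assumes "p \<in> S" "f \<in> V"
  shows "dist_wrt p f f = 0"
  using seminorm_scale[OF assms, of 0] by (simp add: dist_wrt_def)

lemma dist_wrt_commute:
  assumes "p \<in> S" "f \<in> V" "g \<in> V"
  shows "dist_wrt p f g = dist_wrt p g f"
  using seminorm_scale[OF assms(1) diff_closed[OF assms(2,3)], of "- 1"]
  by (simp add: dist_wrt_def)

lemma dist_wrt_add:
  assumes "p \<in> S" "f \<in> V" "g \<in> V" "h \<in> V" "k \<in> V"
  shows "dist_wrt p (\<lambda>x. f x + h x) (\<lambda>x. g x + k x) \<le> dist_wrt p f g + dist_wrt p h k"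
proof -
  have "ennreal (dist_wrt p (\<lambda>x. f x + h x) (\<lambda>x. g x + k x))
      = p (\<lambda>x. (f x + h x) - (g x + k x))"
    using assms by (intro ennreal_dist_wrt add_closed)
  also have "\<dots> = p (\<lambda>x. (f x - g x) + (h x - k x))"
    by (simp add: algebra_simps)
  also have "\<dots> \<le> p (\<lambda>x. f x - g x) + p (\<lambda>x. h x - k x)"
    using assms by (intro seminorm_triangle diff_closed)
  also have "\<dots> = ennreal (dist_wrt p f g + dist_wrt p h k)"
    using assms by (simp add: ennreal_plus ennreal_dist_wrt dist_wrt_nonneg)
  finally show ?thesis
    by (simp add: dist_wrt_nonneg del: ennreal_plus)
qed

lemma dist_wrt_triangle:
  assumes "p \<in> S" "f \<in> V" "g \<in> V" "h \<in> V"
  shows "dist_wrt p f h \<le> dist_wrt p f g + dist_wrt p g h"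
proof -
  have "(\<lambda>x. f x - h x) = (\<lambda>x. (f x + g x) - (g x + h x))"
    by (simp add: algebra_simps)
  then have "dist_wrt p f h = dist_wrt p (\<lambda>x. f x + g x) (\<lambda>x. g x + h x)"
    by (simp add: dist_wrt_def)
  then show ?thesis
    using dist_wrt_add[OF assms(1-3) assms(3,4)] by simp
qed

lemma openin_seminorm_ball:
  assumes "p \<in> S" "f \<in> V" "0 < e"
  shows "openin (seminorm_topology V S) {g \<in> V. dist_wrt p g f < e}"
proof -
  have "{g \<in> V. dist_wrt p g f < e} = {g \<in> V. p (\<lambda>x. g x - f x) < ennreal e}"
    using assms dist_wrt_less_iff by blast
  then show ?thesis
    unfolding seminorm_topology_def using assms
    by (auto intro!: topology_generated_by_Basis)
qed

lemma topspace_seminorm_topology: "topspace (seminorm_topology V S) = V"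
proof
  show "topspace (seminorm_topology V S) \<subseteq> V"
    by (auto simp: seminorm_topology_def topology_generated_by_topspace)
  obtain p where "p \<in> S"
    using seminorms_nonempty by blast
  then show "V \<subseteq> topspace (seminorm_topology V S)"
    using openin_subset[OF openin_seminorm_ball[of p _ 1]] dist_wrt_self by fastforce
qed

lemma openin_finite_seminorm_ball:
  assumes "finite F" "F \<subseteq> S" "f \<in> V" "0 < e"
  shows "openin (seminorm_topology V S) {g \<in> V. \<forall>p\<in>F. dist_wrt p g f < e}"
  using assms(1,2)
proof (induction F)
  case empty
  then show ?case
    using openin_topspace[of "seminorm_topology V S"] by (simp add: topspace_seminorm_topology)
next
  case (insert p F)
  have "{g \<in> V. \<forall>p\<in>insert p F. dist_wrt p g f < e}
      = {g \<in> V. dist_wrt p g f < e} \<inter> {g \<in> V. \<forall>p\<in>F. dist_wrt p g f < e}"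
    by auto
  then show ?case
    using insert openin_seminorm_ball[of p f e] assms(3,4) by (auto intro: openin_Int)
qed

lemma open_contains_finite_seminorm_ball:
  assumes "openin (seminorm_topology V S) U" "f \<in> U"
  shows "\<exists>F e. finite F \<and> F \<subseteq> S \<and> 0 < e \<and> {g \<in> V. \<forall>p\<in>F. dist_wrt p g f < e} \<subseteq> U"
proof -
  have "generate_topology_on
      {{g \<in> V. p (\<lambda>x. g x - f x) < ennreal e} |p f e. p \<in> S \<and> f \<in> V \<and> 0 < e} U"
    using assms(1) by (simp add: seminorm_topology_def openin_topology_generated_by_iff)
  then show ?thesis
    using assms(2)
  proof (induction U rule: generate_topology_on.induct)
    case Empty
    then show ?case by simp
  next
    case (Int U W)
    from Int.prems have "f \<in> U" "f \<in> W"
      by auto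
    obtain F d where F: "finite F" "F \<subseteq> S" "0 < d" "{g \<in> V. \<forall>p\<in>F. dist_wrt p g f < d} \<subseteq> U"
      using Int.IH(1)[OF \<open>f \<in> U\<close>] by (elim exE conjE)
    obtain G e where G: "finite G" "G \<subseteq> S" "0 < e" "{g \<in> V. \<forall>p\<in>G. dist_wrt p g f < e} \<subseteq> W"
      using Int.IH(2)[OF \<open>f \<in> W\<close>] by (elim exE conjE)
    have "{g \<in> V. \<forall>p\<in>F \<union> G. dist_wrt p g f < min d e} \<subseteq> U \<inter> W"
      using F(4) G(4) by auto
    then show ?case
      using F(1-3) G(1-3) by (intro exI[of _ "F \<union> G"] exI[of _ "min d e"]) simp
  next
    case (UN K)
    then obtain W where "W \<in> K" "f \<in> W" by blast
    obtain F e where F: "finite F" "F \<subseteq> S" "0 < e" "{g \<in> V. \<forall>p\<in>F. dist_wrt p g f < e} \<subseteq> W"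
      using UN.IH[OF \<open>W \<in> K\<close> \<open>f \<in> W\<close>] by (elim exE conjE)
    have "{g \<in> V. \<forall>p\<in>F. dist_wrt p g f < e} \<subseteq> \<Union>K"
      using F(4) \<open>W \<in> K\<close> by (rule order_trans[OF _ Union_upper])
    with F(1-3) show ?case
      by (intro exI conjI)
  next
    case (Basis U)
    then obtain p f0 e where p: "p \<in> S" "f0 \<in> V" "0 < e"
      and U: "U = {g \<in> V. p (\<lambda>x. g x - f0 x) < ennreal e}"
      by blast
    have U: "U = {g \<in> V. dist_wrt p g f0 < e}"
      unfolding U using p dist_wrt_less_iff by blast
    have f: "f \<in> V" "dist_wrt p f f0 < e"
      using Basis.prems U by auto
    have "dist_wrt p g f0 < e" if "g \<in> V" "dist_wrt p g f < e - dist_wrt p f f0" for g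
      using dist_wrt_triangle[OF p(1) that(1) f(1) p(2)] that(2) by simp
    then have "{g \<in> V. \<forall>p\<in>{p}. dist_wrt p g f < e - dist_wrt p f f0} \<subseteq> U"
      unfolding U by blast
    then show ?case
      using p(1) f(2)
      by (intro exI[of _ "{p}"] exI[of _ "e - dist_wrt p f f0"]) auto
  qed
qed

text \<open>The finite sets \<open>F\<close> cannot be reduced to singletons: no seminorm in \<open>S\<close> has to dominate two
  given ones, so two separate approximations of \<open>f\<close> need not come from one element of \<open>D\<close>.\<close>

lemma in_closure_iff_approximable:
  assumes "D \<subseteq> V"
  shows "f \<in> seminorm_topology V S closure_of D \<longleftrightarrow>
    f \<in> V \<and> (\<forall>F e. finite F \<and> F \<subseteq> S \<and> 0 < e \<longrightarrow> (\<exists>g\<in>D. \<forall>p\<in>F. dist_wrt p g f < e))"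
    (is "?L \<longleftrightarrow> ?R")
proof
  assume L: ?L
  then have "f \<in> V"
    by (simp add: in_closure_of topspace_seminorm_topology)
  moreover have "\<exists>g\<in>D. \<forall>p\<in>F. dist_wrt p g f < e" if "finite F" "F \<subseteq> S" "0 < e" for F e
  proof -
    have "f \<in> {g \<in> V. \<forall>p\<in>F. dist_wrt p g f < e}"
      using \<open>f \<in> V\<close> that dist_wrt_self by auto
    then have "\<exists>g. g \<in> D \<and> g \<in> {g \<in> V. \<forall>p\<in>F. dist_wrt p g f < e}"
      using L openin_finite_seminorm_ball[OF that(1,2) \<open>f \<in> V\<close> that(3)]
      unfolding in_closure_of by (elim conjE allE[where x="{g \<in> V. \<forall>p\<in>F. dist_wrt p g f < e}"]) simp
    then show ?thesis
      by blast
  qed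
  ultimately show ?R by blast
next
  assume R: ?R
  have "\<exists>g. g \<in> D \<and> g \<in> U" if U: "f \<in> U" "openin (seminorm_topology V S) U" for U
  proof -
    obtain F e where F: "finite F" "F \<subseteq> S" "0 < e" "{g \<in> V. \<forall>p\<in>F. dist_wrt p g f < e} \<subseteq> U"
      using open_contains_finite_seminorm_ball[OF U(2,1)] by (elim exE conjE)
    from R F(1-3) have "\<exists>g\<in>D. \<forall>p\<in>F. dist_wrt p g f < e"
      by simp
    then obtain g where "g \<in> D" "\<forall>p\<in>F. dist_wrt p g f < e"
      by blast
    then show ?thesis
      using F(4) assms by blast
  qed
  then show ?L
    using R by (auto simp: in_closure_of topspace_seminorm_topology)
qed

lemma closure_add_closed:
  assumes D: "D \<subseteq> V" and D_add: "\<And>f g. f \<in> D \<Longrightarrow> g \<in> D \<Longrightarrow> (\<lambda>x. f x + g x) \<in> D"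
    and f: "f \<in> seminorm_topology V S closure_of D" and g: "g \<in> seminorm_topology V S closure_of D"
  shows "(\<lambda>x. f x + g x) \<in> seminorm_topology V S closure_of D"
proof -
  have V: "f \<in> V" "g \<in> V"
    using f g by (simp_all add: in_closure_iff_approximable[OF D])
  have "\<exists>h\<in>D. \<forall>p\<in>F. dist_wrt p h (\<lambda>x. f x + g x) < e" if F: "finite F" "F \<subseteq> S" "0 < e" for F e
  proof -
    have "0 < e / 2"
      using F(3) by simp
    obtain f' where f': "f' \<in> D" "\<forall>p\<in>F. dist_wrt p f' f < e / 2"
      using f F(1,2) \<open>0 < e / 2\<close> unfolding in_closure_iff_approximable[OF D] by meson
    obtain g' where g': "g' \<in> D" "\<forall>p\<in>F. dist_wrt p g' g < e / 2"
      using g F(1,2) \<open>0 < e / 2\<close> unfolding in_closure_iff_approximable[OF D] by meson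
    have "dist_wrt p (\<lambda>x. f' x + g' x) (\<lambda>x. f x + g x) < e" if "p \<in> F" for p
      using dist_wrt_add[of p f' f g' g] f' g' V D F(2) that by fastforce
    then show ?thesis
      using D_add[OF f'(1) g'(1)] by blast
  qed
  then show ?thesis
    using add_closed[OF V] by (simp add: in_closure_iff_approximable[OF D])
qed

lemma closure_scale_closed:
  assumes D: "D \<subseteq> V" and D_scale: "\<And>f c. f \<in> D \<Longrightarrow> (\<lambda>x. c * f x) \<in> D"
    and f: "f \<in> seminorm_topology V S closure_of D"
  shows "(\<lambda>x. c * f x) \<in> seminorm_topology V S closure_of D"
proof -
  have V: "f \<in> V"
    using f by (simp add: in_closure_iff_approximable[OF D])
  have "\<exists>h\<in>D. \<forall>p\<in>F. dist_wrt p h (\<lambda>x. c * f x) < e" if F: "finite F" "F \<subseteq> S" "0 < e" for F e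
  proof -
    \<comment> \<open>The summand \<open>1\<close> allows for \<open>c = 0\<close>.\<close>
    have pos: "0 < e / (cmod c + 1)"
      using F(3) by (simp add: add_nonneg_pos)
    then obtain f' where f': "f' \<in> D" "\<forall>p\<in>F. dist_wrt p f' f < e / (cmod c + 1)"
      using f F(1,2) unfolding in_closure_iff_approximable[OF D] by meson
    have "dist_wrt p (\<lambda>x. c * f' x) (\<lambda>x. c * f x) < e" if "p \<in> F" for p
    proof -
      have "dist_wrt p (\<lambda>x. c * f' x) (\<lambda>x. c * f x) = cmod c * dist_wrt p f' f"
        using dist_wrt_scale f'(1) V D F(2) that by blast
      also have "\<dots> \<le> (cmod c + 1) * dist_wrt p f' f"
        by (simp add: mult_right_mono dist_wrt_nonneg)
      also have "\<dots> < e"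
        using f'(2) that by (simp add: pos_less_divide_eq add_nonneg_pos mult.commute)
      finally show ?thesis .
    qed
    then show ?thesis
      using D_scale[OF f'(1)] by blast
  qed
  then show ?thesis
    using scale_closed[OF V] by (simp add: in_closure_iff_approximable[OF D])
qed

text \<open>The values of \<open>T\<close> along any approximating sequence form a Cauchy sequence. Its limit is
  characterised without reference to the sequence, by an inequality against all of \<open>D\<close>; all
  properties of the extension can be read off from that inequality.\<close>

lemma extension_value_exists:
  fixes T :: "('x \<Rightarrow> complex) \<Rightarrow> 'a::banach"
  assumes D: "D \<subseteq> V" and p: "p \<in> S" and B: "0 \<le> B"
    and lip: "\<And>g h. g \<in> D \<Longrightarrow> h \<in> D \<Longrightarrow> norm (T g - T h) \<le> B * dist_wrt p g h"
    and f: "f \<in> seminorm_topology V S closure_of D"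
  shows "\<exists>y. \<forall>g\<in>D. norm (T g - y) \<le> B * dist_wrt p g f"
proof -
  have V: "f \<in> V"
    using f by (simp add: in_closure_iff_approximable[OF D])
  have "\<exists>g\<in>D. dist_wrt p g f < inverse (real (Suc n))" for n
  proof -
    have "finite {p} \<and> {p} \<subseteq> S \<and> 0 < inverse (real (Suc n))"
      using p by simp
    then have "\<exists>g\<in>D. \<forall>q\<in>{p}. dist_wrt q g f < inverse (real (Suc n))"
      using f unfolding in_closure_iff_approximable[OF D] by meson
    then show ?thesis by simp
  qed
  then obtain s where s: "\<And>n. s n \<in> D" "\<And>n. dist_wrt p (s n) f < inverse (real (Suc n))"
    by metis
  have lim0: "(\<lambda>n. dist_wrt p (s n) f) \<longlonglongrightarrow> 0"
    by (rule tendsto_sandwich[OF _ _ tendsto_const LIMSEQ_inverse_real_of_nat])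
      (simp_all add: dist_wrt_nonneg less_imp_le[OF s(2)] del: of_nat_Suc)
  have lip': "norm (T g - T (s n)) \<le> B * (dist_wrt p g f + dist_wrt p (s n) f)" if "g \<in> D" for g n
  proof -
    have "g \<in> V" "s n \<in> V"
      using that s(1) D by auto
    then have "dist_wrt p g (s n) \<le> dist_wrt p g f + dist_wrt p (s n) f"
      using dist_wrt_triangle[OF p, of g f "s n"] dist_wrt_commute[OF p, of f "s n"] V by simp
    then show ?thesis
      using lip[OF that s(1)] B by (meson mult_left_mono order_trans)
  qed
  have "Cauchy (\<lambda>n. T (s n))"
    unfolding Cauchy_iff
  proof (intro allI impI)
    fix e :: real assume "0 < e"
    have "(\<lambda>n. B * dist_wrt p (s n) f) \<longlonglongrightarrow> B * 0"
      by (intro tendsto_intros lim0)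
    then have "\<forall>\<^sub>F n in sequentially. B * dist_wrt p (s n) f < e / 2"
      using \<open>0 < e\<close> by (intro order_tendstoD) auto
    then obtain M where M: "\<And>n. n \<ge> M \<Longrightarrow> B * dist_wrt p (s n) f < e / 2"
      by (auto simp: eventually_sequentially)
    have "norm (T (s m) - T (s n)) < e" if "m \<ge> M" "n \<ge> M" for m n
      using lip'[OF s(1), of m n] M[OF that(1)] M[OF that(2)] by (simp add: distrib_left)
    then show "\<exists>M. \<forall>m\<ge>M. \<forall>n\<ge>M. norm (T (s m) - T (s n)) < e"
      by blast
  qed
  then obtain y where y: "(\<lambda>n. T (s n)) \<longlonglongrightarrow> y"
    using Cauchy_convergent_iff convergent_def by blast
  have "norm (T g - y) \<le> B * dist_wrt p g f" if "g \<in> D" for g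
  proof (rule tendsto_le[OF sequentially_bot])
    show "(\<lambda>n. norm (T g - T (s n))) \<longlonglongrightarrow> norm (T g - y)"
      by (intro tendsto_intros y)
    have "(\<lambda>n. B * (dist_wrt p g f + dist_wrt p (s n) f)) \<longlonglongrightarrow> B * (dist_wrt p g f + 0)"
      by (intro tendsto_intros lim0)
    then show "(\<lambda>n. B * (dist_wrt p g f + dist_wrt p (s n) f)) \<longlonglongrightarrow> B * dist_wrt p g f"
      by simp
    show "\<forall>\<^sub>F n in sequentially. norm (T g - T (s n)) \<le> B * (dist_wrt p g f + dist_wrt p (s n) f)"
      using lip'[OF that] by simp
  qed
  then show ?thesis by blast
qed

lemma continuous_map_from_lipschitz:
  fixes \<Phi> :: "('x \<Rightarrow> complex) \<Rightarrow> 'a::real_normed_vector"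
  assumes C: "C \<subseteq> V" and p: "p \<in> S" and B: "0 \<le> B"
    and lip: "\<And>f g. f \<in> C \<Longrightarrow> g \<in> C \<Longrightarrow> norm (\<Phi> f - \<Phi> g) \<le> B * dist_wrt p f g"
  shows "continuous_map (subtopology (seminorm_topology V S) C) euclidean \<Phi>"
proof -
  have top: "topspace (subtopology (seminorm_topology V S) C) = C"
    using C by (auto simp: topspace_seminorm_topology)
  have "openin (subtopology (seminorm_topology V S) C) {f \<in> C. \<Phi> f \<in> U}" if "open U" for U
  proof (subst openin_subopen, safe)
    fix f assume f: "f \<in> C" "\<Phi> f \<in> U"
    obtain e where e: "0 < e" "ball (\<Phi> f) e \<subseteq> U"
      using \<open>open U\<close> f(2) openE by blast
    \<comment> \<open>The summand \<open>1\<close> allows for \<open>B = 0\<close>.\<close>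
    define W where "W = {g \<in> V. dist_wrt p g f < e / (B + 1)} \<inter> C"
    have "openin (subtopology (seminorm_topology V S) C) W"
      unfolding W_def openin_subtopology
      using openin_seminorm_ball[OF p, of f "e / (B + 1)"] f(1) C B e(1) by auto
    moreover have "f \<in> W"
      using f(1) C dist_wrt_self[OF p] B e(1) by (auto simp: W_def)
    moreover have "W \<subseteq> {f \<in> C. \<Phi> f \<in> U}"
    proof
      fix g assume g: "g \<in> W"
      then have gC: "g \<in> C" and gd: "dist_wrt p g f < e / (B + 1)"
        by (auto simp: W_def)
      have "norm (\<Phi> g - \<Phi> f) \<le> B * dist_wrt p g f"
        by (rule lip[OF gC f(1)])
      also have "\<dots> \<le> (B + 1) * dist_wrt p g f"
        by (simp add: mult_right_mono dist_wrt_nonneg)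
      also have "\<dots> < e"
        using gd B by (simp add: pos_less_divide_eq mult.commute)
      finally have "\<Phi> g \<in> ball (\<Phi> f) e"
        by (simp add: dist_norm norm_minus_commute)
      then show "g \<in> {f \<in> C. \<Phi> f \<in> U}"
        using e(2) gC by blast
    qed
    ultimately show "\<exists>T. openin (subtopology (seminorm_topology V S) C) T \<and> f \<in> T \<and>
        T \<subseteq> {f \<in> C. \<Phi> f \<in> U}"
      by blast
  qed
  then show ?thesis
    unfolding continuous_map_def top by simp
qed

theorem bounded_linear_extension_unique:
  fixes T :: "('x \<Rightarrow> complex) \<Rightarrow> 'a::unital_cstar_algebra"
  assumes D: "D \<subseteq> V"
    and D_add: "\<And>f g. f \<in> D \<Longrightarrow> g \<in> D \<Longrightarrow> (\<lambda>x. f x + g x) \<in> D"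
    and D_scale: "\<And>f c. f \<in> D \<Longrightarrow> (\<lambda>x. c * f x) \<in> D"
    and lin: "clinear_on D T"
    and p: "p \<in> S" and B: "0 \<le> B"
    and bound: "\<And>f. f \<in> D \<Longrightarrow> ennreal (norm (T f)) \<le> p f * ennreal B"
  defines "C \<equiv> seminorm_topology V S closure_of D"
  shows "\<exists>!\<Phi>. \<Phi> \<in> extensional C \<and> clinear_on C \<Phi> \<and>
    continuous_map (subtopology (seminorm_topology V S) C) euclidean \<Phi> \<and> (\<forall>f\<in>D. \<Phi> f = T f)"
proof -
  have CV: "C \<subseteq> V"
    using closure_of_subset_topspace[of "seminorm_topology V S" D]
    by (simp add: C_def topspace_seminorm_topology)
  have DC: "D \<subseteq> C"
    using closure_of_subset[of D "seminorm_topology V S"] D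
    by (simp add: C_def topspace_seminorm_topology)
  have lip: "norm (T f - T g) \<le> B * dist_wrt p f g" if "f \<in> D" "g \<in> D" for f g
  proof -
    have "(\<lambda>x. f x + - 1 * g x) \<in> D"
      using D_add[OF that(1) D_scale[OF that(2), of "- 1"]] by blast
    then have "(\<lambda>x. f x - g x) \<in> D"
      by simp
    then have "ennreal (norm (T f - T g)) \<le> p (\<lambda>x. f x - g x) * ennreal B"
      using bound clinear_on_diff[OF lin that D_scale] by metis
    also have "\<dots> = ennreal (B * dist_wrt p f g)"
      using ennreal_dist_wrt[OF p, of f g] that D
      by (simp add: subset_iff ennreal_mult'[OF B] mult.commute)
    finally show ?thesis
      using B by (simp add: dist_wrt_nonneg)
  qed
  define \<Phi> where
    "\<Phi> = restrict (\<lambda>f. SOME y. \<forall>g\<in>D. norm (T g - y) \<le> B * dist_wrt p g f) C"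
  have \<Phi>: "norm (T g - \<Phi> f) \<le> B * dist_wrt p g f" if "f \<in> C" "g \<in> D" for f g
    using someI_ex[OF extension_value_exists[where T=T, OF D p B lip]] that
    by (simp add: \<Phi>_def C_def)
  have approx: "\<exists>g\<in>D. B * dist_wrt p g f < e" if "f \<in> C" "0 < e" for f e
  proof -
    have "finite {p} \<and> {p} \<subseteq> S \<and> 0 < e / (B + 1)"
      using p that(2) B by simp
    then have "\<exists>g\<in>D. \<forall>q\<in>{p}. dist_wrt q g f < e / (B + 1)"
      using that(1) unfolding C_def in_closure_iff_approximable[OF D] by meson
    then obtain g where g: "g \<in> D" "dist_wrt p g f < e / (B + 1)"
      by auto
    have "B * dist_wrt p g f \<le> (B + 1) * dist_wrt p g f"
      by (simp add: mult_right_mono dist_wrt_nonneg)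
    also have "\<dots> < e"
      using g(2) B by (simp add: pos_less_divide_eq mult.commute)
    finally show ?thesis
      using g(1) by blast
  qed
  \<comment> \<open>A value is recognised by approximation, so that sums and multiples are computed by
    approximating each argument in \<open>D\<close>, where \<open>T\<close> is linear.\<close>
  have value_unique: "\<Phi> f = y"
    if f: "f \<in> C" and y: "\<And>e. 0 < e \<Longrightarrow> \<exists>g\<in>D. B * dist_wrt p g f < e \<and> norm (T g - y) < e" for f y
  proof (rule ccontr)
    assume "\<Phi> f \<noteq> y"
    then have pos: "0 < norm (\<Phi> f - y) / 2"
      by simp
    then obtain g where g: "g \<in> D" "B * dist_wrt p g f < norm (\<Phi> f - y) / 2"
        "norm (T g - y) < norm (\<Phi> f - y) / 2"
      using y by blast
    have "norm (\<Phi> f - y) \<le> norm (T g - \<Phi> f) + norm (T g - y)"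
      using norm_triangle_ineq4[of "T g - y" "T g - \<Phi> f"] by simp
    then show False
      using \<Phi>[OF f g(1)] g(2,3) by simp
  qed
  have extends: "\<Phi> f = T f" if "f \<in> D" for f
  proof (rule value_unique)
    show "f \<in> C"
      using that DC by blast
    show "\<exists>g\<in>D. B * dist_wrt p g f < e \<and> norm (T g - T f) < e" if "0 < e" for e
      using \<open>f \<in> D\<close> that D dist_wrt_self[OF p, of f] by (intro bexI[of _ f]) auto
  qed
  have add: "\<Phi> (\<lambda>x. f x + g x) = \<Phi> f + \<Phi> g" if f: "f \<in> C" and g: "g \<in> C" for f g
  proof (rule value_unique)
    show "(\<lambda>x. f x + g x) \<in> C"
      using closure_add_closed[OF D D_add] f g unfolding C_def by blast
    fix e :: real assume "0 < e"
    then obtain f' where f': "f' \<in> D" "B * dist_wrt p f' f < e / 2"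
      using approx[OF f, of "e / 2"] by auto
    obtain g' where g': "g' \<in> D" "B * dist_wrt p g' g < e / 2"
      using approx[OF g, of "e / 2"] \<open>0 < e\<close> by auto
    have "dist_wrt p (\<lambda>x. f' x + g' x) (\<lambda>x. f x + g x) \<le> dist_wrt p f' f + dist_wrt p g' g"
      using dist_wrt_add[OF p] f'(1) g'(1) f g D CV by blast
    then have "B * dist_wrt p (\<lambda>x. f' x + g' x) (\<lambda>x. f x + g x)
        \<le> B * dist_wrt p f' f + B * dist_wrt p g' g"
      using B by (metis distrib_left mult_left_mono)
    then have 1: "B * dist_wrt p (\<lambda>x. f' x + g' x) (\<lambda>x. f x + g x) < e"
      using f'(2) g'(2) by simp
    have "T (\<lambda>x. f' x + g' x) = T f' + T g'"
      using lin f'(1) g'(1) by (simp add: clinear_on_def)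
    then have "norm (T (\<lambda>x. f' x + g' x) - (\<Phi> f + \<Phi> g)) \<le> norm (T f' - \<Phi> f) + norm (T g' - \<Phi> g)"
      by (simp add: norm_diff_triangle_ineq)
    then have 2: "norm (T (\<lambda>x. f' x + g' x) - (\<Phi> f + \<Phi> g)) < e"
      using \<Phi>[OF f f'(1)] \<Phi>[OF g g'(1)] f'(2) g'(2) by simp
    show "\<exists>h\<in>D. B * dist_wrt p h (\<lambda>x. f x + g x) < e \<and> norm (T h - (\<Phi> f + \<Phi> g)) < e"
      using D_add[OF f'(1) g'(1)] 1 2 by blast
  qed
  have scale: "\<Phi> (\<lambda>x. c * f x) = c *\<^sub>C \<Phi> f" if f: "f \<in> C" for f c
  proof (rule value_unique)
    show "(\<lambda>x. c * f x) \<in> C"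
      using closure_scale_closed[OF D D_scale] f unfolding C_def by blast
    fix e :: real assume "0 < e"
    \<comment> \<open>Both errors are \<open>cmod c\<close> times that of \<open>f'\<close>.\<close>
    then have "0 < e / (cmod c + 1)"
      by (simp add: add_nonneg_pos)
    then obtain f' where f': "f' \<in> D" "B * dist_wrt p f' f < e / (cmod c + 1)"
      using approx[OF f] by blast
    have *: "cmod c * (B * dist_wrt p f' f) < e"
    proof -
      have "cmod c * (B * dist_wrt p f' f) \<le> (cmod c + 1) * (B * dist_wrt p f' f)"
        using B by (simp add: mult_right_mono dist_wrt_nonneg)
      also have "\<dots> < e"
        using f'(2) by (simp add: pos_less_divide_eq add_nonneg_pos mult.commute)
      finally show ?thesis .
    qed
    have "dist_wrt p (\<lambda>x. c * f' x) (\<lambda>x. c * f x) = cmod c * dist_wrt p f' f"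
      using dist_wrt_scale[OF p] f'(1) f D CV by blast
    then have 1: "B * dist_wrt p (\<lambda>x. c * f' x) (\<lambda>x. c * f x) < e"
      using * by (simp add: mult.left_commute)
    have "T (\<lambda>x. c * f' x) = c *\<^sub>C T f'"
      using lin f'(1) by (simp add: clinear_on_def)
    then have "norm (T (\<lambda>x. c * f' x) - c *\<^sub>C \<Phi> f) = cmod c * norm (T f' - \<Phi> f)"
      by (metis scaleC_diff_right norm_scaleC)
    also have "\<dots> \<le> cmod c * (B * dist_wrt p f' f)"
      using \<Phi>[OF f f'(1)] by (simp add: mult_left_mono)
    finally have 2: "norm (T (\<lambda>x. c * f' x) - c *\<^sub>C \<Phi> f) < e"
      using * by simp
    show "\<exists>h\<in>D. B * dist_wrt p h (\<lambda>x. c * f x) < e \<and> norm (T h - c *\<^sub>C \<Phi> f) < e"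
      using D_scale[OF f'(1)] 1 2 by blast
  qed
  have lip_ext: "norm (\<Phi> f - \<Phi> g) \<le> B * dist_wrt p f g" if f: "f \<in> C" and g: "g \<in> C" for f g
  proof (rule field_le_epsilon)
    fix e :: real assume "0 < e"
    then obtain h where h: "h \<in> D" "B * dist_wrt p h f < e / 2"
      using approx[OF f, of "e / 2"] by auto
    have "dist_wrt p h g \<le> dist_wrt p h f + dist_wrt p f g"
      using dist_wrt_triangle[OF p] h(1) f g D CV by blast
    then have "B * dist_wrt p h g \<le> B * dist_wrt p h f + B * dist_wrt p f g"
      using B by (metis distrib_left mult_left_mono)
    moreover have "norm (\<Phi> f - \<Phi> g) \<le> norm (T h - \<Phi> f) + norm (T h - \<Phi> g)"
      using norm_triangle_ineq4[of "T h - \<Phi> g" "T h - \<Phi> f"] by simp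
    ultimately show "norm (\<Phi> f - \<Phi> g) \<le> B * dist_wrt p f g + e"
      using \<Phi>[OF f h(1)] \<Phi>[OF g h(1)] h(2) by simp
  qed
  show ?thesis
  proof (rule ex1I[of _ \<Phi>])
    show "\<Phi> \<in> extensional C \<and> clinear_on C \<Phi> \<and>
      continuous_map (subtopology (seminorm_topology V S) C) euclidean \<Phi> \<and> (\<forall>f\<in>D. \<Phi> f = T f)"
      using add scale extends continuous_map_from_lipschitz[OF CV p B lip_ext]
      by (simp add: clinear_on_def) (simp add: \<Phi>_def)
  next
    fix \<Psi>
    assume \<Psi>: "\<Psi> \<in> extensional C \<and> clinear_on C \<Psi> \<and>
      continuous_map (subtopology (seminorm_topology V S) C) euclidean \<Psi> \<and> (\<forall>f\<in>D. \<Psi> f = T f)"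
    have dense: "subtopology (seminorm_topology V S) C closure_of D = C"
      using DC by (simp add: closure_of_subtopology C_def Int_absorb1)
    have "\<Psi> f = \<Phi> f" if "f \<in> C" for f
      using forall_in_closure_of_eq[of f "subtopology (seminorm_topology V S) C" D euclidean \<Psi> \<Phi>]
        that dense \<Psi> extends continuous_map_from_lipschitz[OF CV p B lip_ext]
      by simp
    moreover have "\<Phi> \<in> extensional C"
      by (simp add: \<Phi>_def)
    ultimately show "\<Psi> = \<Phi>"
      using \<Psi> by (intro extensionalityI[of \<Psi> C \<Phi>]) auto
  qed
qed

end

section \<open>The function spaces of a family of norms on cubes\<close>

lemma topspace_cube: "topspace (subtopology (Euclidean_space m) (cube r m)) = cube r m"
  by (auto simp: cube_def)

lemma cfuns_add: "f \<in> cfuns X \<Longrightarrow> g \<in> cfuns X \<Longrightarrow> (\<lambda>x. f x + g x) \<in> cfuns X"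
  by (auto simp: cfuns_def intro: continuous_map_add)

lemma cfuns_scale: "f \<in> cfuns X \<Longrightarrow> (\<lambda>x. c * f x) \<in> cfuns X"
  using continuous_map_compose[of X euclidean f euclidean "\<lambda>z. c * z"]
  by (auto simp: cfuns_def o_def intro!: continuous_intros)

lemma restrict0_cube_in_cfuns:
  assumes "f \<in> cfuns (Euclidean_space m)"
  shows "restrict0 (cube r m) f \<in> cfuns (subtopology (Euclidean_space m) (cube r m))"
proof -
  have "continuous_map (subtopology (Euclidean_space m) (cube r m)) euclidean f"
    using assms by (simp add: cfuns_def continuous_map_from_subtopology)
  then have "continuous_map (subtopology (Euclidean_space m) (cube r m)) euclidean
      (restrict0 (cube r m) f)"
    by (rule continuous_map_eq) (simp add: restrict0_def topspace_cube)
  then show ?thesis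
    unfolding cfuns_def topspace_cube by (simp add: restrict0_def)
qed

lemma norm_on_cube_add:
  assumes "inf_norm_family \<alpha>" "0 < r" "1 \<le> m"
    and "f \<in> cfuns (Euclidean_space m)" "g \<in> cfuns (Euclidean_space m)"
  shows "norm_on_cube \<alpha> r m (\<lambda>x. f x + g x) \<le> norm_on_cube \<alpha> r m f + norm_on_cube \<alpha> r m g"
proof -
  have "restrict0 (cube r m) (\<lambda>x. f x + g x)
      = (\<lambda>x. restrict0 (cube r m) f x + restrict0 (cube r m) g x)"
    by (auto simp: restrict0_def)
  then show ?thesis
    using assms restrict0_cube_in_cfuns
    by (simp add: norm_on_cube_def inf_norm_family_def inf_norm_on_def)
qed

lemma norm_on_cube_scale:
  assumes "inf_norm_family \<alpha>" "0 < r" "1 \<le> m" "f \<in> cfuns (Euclidean_space m)"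
  shows "norm_on_cube \<alpha> r m (\<lambda>x. c * f x) = ennreal (cmod c) * norm_on_cube \<alpha> r m f"
proof -
  have "restrict0 (cube r m) (\<lambda>x. c * f x) = (\<lambda>x. c * restrict0 (cube r m) f x)"
    by (auto simp: restrict0_def)
  then show ?thesis
    using assms restrict0_cube_in_cfuns
    by (simp add: norm_on_cube_def inf_norm_family_def inf_norm_on_def)
qed

lemma seminormed_function_space_fin_funs:
  assumes "inf_norm_family \<alpha>" "1 \<le> m"
  shows "seminormed_function_space (fin_funs \<alpha> m) {norm_on_cube \<alpha> r m |r. 0 < r}"
proof
  show "(\<lambda>x. f x + g x) \<in> fin_funs \<alpha> m" if "f \<in> fin_funs \<alpha> m" "g \<in> fin_funs \<alpha> m" for f g
  proof -
    have "norm_on_cube \<alpha> r m (\<lambda>x. f x + g x) < \<infinity>" if "0 < r" for r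
    proof -
      have "norm_on_cube \<alpha> r m f + norm_on_cube \<alpha> r m g < \<infinity>"
        using \<open>f \<in> _\<close> \<open>g \<in> _\<close> that by (simp add: fin_funs_def)
      moreover have "norm_on_cube \<alpha> r m (\<lambda>x. f x + g x) \<le> norm_on_cube \<alpha> r m f + norm_on_cube \<alpha> r m g"
        using norm_on_cube_add[OF assms(1) that assms(2)] \<open>f \<in> _\<close> \<open>g \<in> _\<close> by (simp add: fin_funs_def)
      ultimately show ?thesis
        by (rule order.strict_trans1[rotated])
    qed
    then show ?thesis
      using that cfuns_add by (auto simp: fin_funs_def)
  qed
  show "(\<lambda>x. c * f x) \<in> fin_funs \<alpha> m" if "f \<in> fin_funs \<alpha> m" for f c
    using that assms
    by (auto simp: fin_funs_def cfuns_scale norm_on_cube_scale ennreal_mult_less_top)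
next
  fix p f c assume "p \<in> {norm_on_cube \<alpha> r m |r. 0 < r}" "f \<in> fin_funs \<alpha> m"
  then show "p (\<lambda>x. c * f x) = ennreal (cmod c) * p f" "p f < \<infinity>"
    using assms by (auto simp: fin_funs_def norm_on_cube_scale)
next
  fix p f g assume "p \<in> {norm_on_cube \<alpha> r m |r. 0 < r}" "f \<in> fin_funs \<alpha> m" "g \<in> fin_funs \<alpha> m"
  then show "p (\<lambda>x. f x + g x) \<le> p f + p g"
    using assms by (auto simp: fin_funs_def norm_on_cube_add)
next
  have "norm_on_cube \<alpha> 1 m \<in> {norm_on_cube \<alpha> r m |r. 0 < r}"
    using zero_less_one by blast
  then show "{norm_on_cube \<alpha> r m |r. 0 < r} \<noteq> {}"
    by blast
qed

section \<open>Linearity in the polynomial\<close>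

text \<open>\<open>poly_fun\<close> and \<open>poly_tensor_apply\<close> sum over the monomials with nonzero coefficient, a set that
  can shrink under addition and scaling. Summing over a common larger set makes additivity in each
  coefficient additivity in the polynomial.\<close>

lemma sum_keys_superset:
  fixes F :: "'i \<Rightarrow> 'c::zero \<Rightarrow> 'b::comm_monoid_add"
  assumes "finite K" "Poly_Mapping.keys P \<subseteq> K" "\<And>\<delta>. F \<delta> 0 = 0"
  shows "(\<Sum>\<delta>\<in>Poly_Mapping.keys P. F \<delta> (Poly_Mapping.lookup P \<delta>))
    = (\<Sum>\<delta>\<in>K. F \<delta> (Poly_Mapping.lookup P \<delta>))"
  using assms by (intro sum.mono_neutral_left) (auto simp: in_keys_iff)

lemma sum_keys_add:
  fixes F :: "'i \<Rightarrow> 'c::comm_monoid_add \<Rightarrow> 'b::comm_monoid_add"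
  assumes "\<And>\<delta>. F \<delta> 0 = 0" "\<And>\<delta> c d. F \<delta> (c + d) = F \<delta> c + F \<delta> d"
  shows "(\<Sum>\<delta>\<in>Poly_Mapping.keys (P + Q). F \<delta> (Poly_Mapping.lookup (P + Q) \<delta>))
    = (\<Sum>\<delta>\<in>Poly_Mapping.keys P. F \<delta> (Poly_Mapping.lookup P \<delta>))
      + (\<Sum>\<delta>\<in>Poly_Mapping.keys Q. F \<delta> (Poly_Mapping.lookup Q \<delta>))"
proof -
  let ?K = "Poly_Mapping.keys P \<union> Poly_Mapping.keys Q"
  have "finite ?K" "Poly_Mapping.keys (P + Q) \<subseteq> ?K"
    by (simp_all add: keys_add)
  then show ?thesis
    using sum_keys_superset[where F=F and K="?K" and P="P + Q", OF _ _ assms(1)]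
      sum_keys_superset[where F=F and K="?K" and P=P, OF _ _ assms(1)]
      sum_keys_superset[where F=F and K="?K" and P=Q, OF _ _ assms(1)]
    by (simp only: lookup_add assms(2) sum.distrib Un_upper1 Un_upper2)
qed

definition scale_poly :: "complex \<Rightarrow> cpoly \<Rightarrow> cpoly"
  where "scale_poly c P = Poly_Mapping.map ((*) c) P"

lemma lookup_scale_poly: "Poly_Mapping.lookup (scale_poly c P) \<delta> = c * Poly_Mapping.lookup P \<delta>"
  by (simp add: scale_poly_def Poly_Mapping.map.rep_eq when_def)

lemma keys_scale_poly: "Poly_Mapping.keys (scale_poly c P) \<subseteq> Poly_Mapping.keys P"
  by (auto simp: in_keys_iff lookup_scale_poly)

lemma polys_add: "P \<in> polys m \<Longrightarrow> Q \<in> polys m \<Longrightarrow> P + Q \<in> polys m"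
  using keys_add[of P Q] by (fastforce simp: polys_def)

lemma polys_scale: "P \<in> polys m \<Longrightarrow> scale_poly c P \<in> polys m"
  using keys_scale_poly[of c P] by (fastforce simp: polys_def)

lemma poly_fun_add: "poly_fun m (P + Q) = (\<lambda>x. poly_fun m P x + poly_fun m Q x)"
proof
  fix x
  show "poly_fun m (P + Q) x = poly_fun m P x + poly_fun m Q x"
    using sum_keys_add[where
        F="\<lambda>\<delta> c. c * (\<Prod>i<m. complex_of_real (x i) ^ Poly_Mapping.lookup \<delta> i)" and P=P and Q=Q]
    by (simp add: poly_fun_def restrict0_def distrib_right)
qed

lemma poly_fun_scale: "poly_fun m (scale_poly c P) = (\<lambda>x. c * poly_fun m P x)"
proof
  fix x
  show "poly_fun m (scale_poly c P) x = c * poly_fun m P x"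
    using sum_keys_superset[OF finite_keys keys_scale_poly, where
        F="\<lambda>\<delta> c. c * (\<Prod>i<m. complex_of_real (x i) ^ Poly_Mapping.lookup \<delta> i)"]
    by (simp add: poly_fun_def restrict0_def lookup_scale_poly sum_distrib_left mult.assoc)
qed

lemma poly_tensor_apply_add:
  "poly_tensor_apply m (P + Q) a b = poly_tensor_apply m P a b + poly_tensor_apply m Q a b"
  unfolding poly_tensor_apply_def
  by (rule sum_keys_add) (simp_all add: scaleC_zero_left scaleC_add_left)

lemma scaleC_sum_right:
  "c *\<^sub>C (\<Sum>i\<in>I. f i) = (\<Sum>i\<in>I. c *\<^sub>C (f i :: 'a::unital_cstar_algebra))"
proof -
  have "c *\<^sub>C (0::'a) = 0"
    using scaleC_diff_right[of c 0 "0::'a"] by simp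
  then show ?thesis
    by (induction I rule: infinite_finite_induct) (simp_all add: scaleC_add_right)
qed

lemma poly_tensor_apply_scale:
  "poly_tensor_apply m (scale_poly c P) a b = c *\<^sub>C poly_tensor_apply m P a b"
  using sum_keys_superset[OF finite_keys keys_scale_poly, where
      F="\<lambda>\<delta> c. c *\<^sub>C (prod_list (map (\<lambda>i. a i ^ Poly_Mapping.lookup \<delta> i * b i) [0..<m - 1])
      * a (m - 1) ^ Poly_Mapping.lookup \<delta> (m - 1))"]
  by (simp add: poly_tensor_apply_def lookup_scale_poly scaleC_zero_left scaleC_sum_right
      scaleC_scaleC)

section \<open>The lexicographic functional calculus\<close>

theorem theorem1p9:
  fixes \<alpha> :: norm_family
    and m :: nat
    and a b :: "nat \<Rightarrow> 'a::unital_cstar_algebra"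
  assumes "inf_norm_family \<alpha>"
    and "finite_on_polys \<alpha>"
    and "\<And>(k::nat) P (c :: nat \<Rightarrow> 'a) (r::real). k \<ge> 2 \<Longrightarrow> P \<in> polys k \<Longrightarrow> r > 0 \<Longrightarrow>
      (SUP x \<in> {x :: nat \<Rightarrow> 'a. \<forall>i<k. x i \<in> self_adjoint_ball r}.
          ennreal (norm (poly_tensor_apply k P x c)))
        \<le> norm_on_cube \<alpha> r k (poly_fun k P) * ennreal (\<Prod>i<k - 1. norm (c i))"
    and "m \<ge> 2"
    and "\<forall>i<m. a i \<in> self_adjoint"
  shows "\<exists>!\<Phi> :: ((nat \<Rightarrow> real) \<Rightarrow> complex) \<Rightarrow> 'a.
    \<Phi> \<in> extensional (poly_closure \<alpha> m) \<and>
    clinear_on (poly_closure \<alpha> m) \<Phi> \<and>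
    continuous_map (poly_closure_topology \<alpha> m) euclidean \<Phi> \<and>
    (\<forall>P\<in>polys m. \<Phi> (poly_fun m P) = poly_tensor_apply m P a b)"
proof -
  have m: "1 \<le> m"
    using assms(4) by simp
  define D where "D = poly_fun m ` polys m"
  define S where "S = {norm_on_cube \<alpha> r m |r. 0 < r}"
  interpret seminormed_function_space "fin_funs \<alpha> m" S
    unfolding S_def by (rule seminormed_function_space_fin_funs[OF assms(1) m])
  have D: "D \<subseteq> fin_funs \<alpha> m"
    using assms(2) m by (simp add: D_def finite_on_polys_def)
  have D_add: "(\<lambda>x. f x + g x) \<in> D" if "f \<in> D" "g \<in> D" for f g
    using that unfolding D_def by (auto simp: polys_add simp flip: poly_fun_add)
  have D_scale: "(\<lambda>x. c * f x) \<in> D" if "f \<in> D" for f c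
    using that unfolding D_def by (auto simp: polys_scale simp flip: poly_fun_scale)

  \<comment> \<open>The summand \<open>1\<close> makes \<open>r\<close> positive even if all \<open>a i\<close> vanish.\<close>
  define r where "r = 1 + (\<Sum>i<m. norm (a i))"
  define B where "B = (\<Prod>i<m - 1. norm (b i))"
  have r: "0 < r"
    by (simp add: r_def add_pos_nonneg sum_nonneg)
  have B: "0 \<le> B"
    by (simp add: B_def prod_nonneg)
  have "norm (a i) \<le> r" if "i < m" for i
    using member_le_sum[of i "{..<m}" "\<lambda>i. norm (a i)"] that by (simp add: r_def)
  then have "\<forall>i<m. a i \<in> self_adjoint_ball r"
    using assms(5) by (simp add: self_adjoint_ball_def)
  then have bound: "ennreal (norm (poly_tensor_apply m P a b))
      \<le> norm_on_cube \<alpha> r m (poly_fun m P) * ennreal B" if P: "P \<in> polys m" for P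
    unfolding B_def
    by (intro order_trans[OF SUP_upper[where f="\<lambda>x. ennreal (norm (poly_tensor_apply m P x b))"]
          assms(3)[OF assms(4) P r]]) simp

  have well_defined: "poly_tensor_apply m P a b = poly_tensor_apply m Q a b"
    if PQ: "P \<in> polys m" "Q \<in> polys m" "poly_fun m P = poly_fun m Q" for P Q
  proof -
    let ?R = "P + scale_poly (- 1) Q"
    have R: "?R \<in> polys m"
      using PQ by (simp add: polys_add polys_scale)
    have "poly_fun m ?R = (\<lambda>x. 0 * poly_fun m P x)"
      by (simp add: poly_fun_add poly_fun_scale PQ(3))
    then have "norm_on_cube \<alpha> r m (poly_fun m ?R) = 0"
      using norm_on_cube_scale[OF assms(1) r m, of "poly_fun m P" 0] PQ(1) D
      by (auto simp: D_def fin_funs_def)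
    then have "poly_tensor_apply m ?R a b = 0"
      using bound[OF R] by simp
    then show ?thesis
      by (simp add: poly_tensor_apply_add poly_tensor_apply_scale scaleC_minus_one)
  qed
  define T where "T f = poly_tensor_apply m (inv_into (polys m) (poly_fun m) f) a b" for f
  have T: "T (poly_fun m P) = poly_tensor_apply m P a b" if "P \<in> polys m" for P
    unfolding T_def using that
    by (intro well_defined) (auto intro: inv_into_into f_inv_into_f)
  have "clinear_on D T"
    unfolding clinear_on_def D_def
    by (auto simp: T polys_add polys_scale poly_tensor_apply_add poly_tensor_apply_scale
        simp flip: poly_fun_add poly_fun_scale)
  moreover have "norm_on_cube \<alpha> r m \<in> S"
    using r by (auto simp: S_def)
  moreover have "ennreal (norm (T f)) \<le> norm_on_cube \<alpha> r m f * ennreal B" if "f \<in> D" for f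
    using that bound by (auto simp: D_def T)
  ultimately have "\<exists>!\<Phi>. \<Phi> \<in> extensional (poly_closure \<alpha> m) \<and> clinear_on (poly_closure \<alpha> m) \<Phi> \<and>
      continuous_map (poly_closure_topology \<alpha> m) euclidean \<Phi> \<and> (\<forall>f\<in>D. \<Phi> f = T f)"
    using bounded_linear_extension_unique[OF D D_add D_scale, of T "norm_on_cube \<alpha> r m" B] B
    unfolding poly_closure_topology_def poly_closure_def fin_funs_topology_def D_def S_def
    by blast
  moreover have "(\<forall>f\<in>D. \<Phi> f = T f) \<longleftrightarrow> (\<forall>P\<in>polys m. \<Phi> (poly_fun m P) = poly_tensor_apply m P a b)"
    for \<Phi> :: "((nat \<Rightarrow> real) \<Rightarrow> complex) \<Rightarrow> 'a"
    by (simp add: D_def T)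
  ultimately show ?thesis
    by simp
qed

end
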